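(* Let $(q,m)$ be a planar $4$-body central configuration. Then $(q,m)$ is balanced and collisionless if and only if, for a suitable enumeration of the bodies, $q_1=-q_3$, $q_2=-q_4$, $m_1=m_3$, $m_2=m_4$, and $(q,m)$ is of one of the following mutually exclusive types: (CCcl) $q_1,q_2,q_3,q_4$ are collinear; (CCr) $q_1,q_2,q_3,q_4$ are the vertices of a rhombus, with $|q_1-q_3|<|q_2-q_4|$ and $m_1>m_2$; (CCs) $q_1,q_2,q_3,q_4$ are the vertices of a square and the four masses are equal.
   Context: Masses are positive and positions are pairwise distinct points of a plane $\Pi\subset\mathbb{R}^3$ through the origin; the center of mass is at the origin. Central configuration: $(q,m)$, $q=(q_1,\dots,q_n)$, $m=(m_1,\dots,m_n)$, is a central configuration (CC) if there is $\lambda\in\mathbb{R}$ with $\nabla_jU(q)+\lambda m_jq_j=0$ for $j=1,\dots,n$, where $U(q)=\sum_{i<j}\frac{m_im_j}{|q_i-q_j|}$. Balanced: a CC is balanced if for every $r>0$ such that $F_r:=\{i:|q_i|=r\}$ is nonempty, one has $\sum_{i\in F_r}m_iq_i=0$. Collisionless: $q_i\neq 0$ for all $i$. In types (CCr) and (CCs), $q_1,q_3$ are opposite vertices and $q_2,q_4$ are opposite vertices. *)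

theory Defs
  imports "HOL-Analysis.Analysis" "HOL-Combinatorics.Permutations"
begin

text \<open>Bodies are indexed by \<open>{1..n}\<close>; values of \<open>q\<close> and \<open>m\<close> at other indices are irrelevant.\<close>

definition planar_config :: "(real^3) set \<Rightarrow> nat \<Rightarrow> (nat \<Rightarrow> real^3) \<Rightarrow> (nat \<Rightarrow> real) \<Rightarrow> bool" where
  "planar_config P n q m \<longleftrightarrow>
     subspace P \<and> dim P = 2 \<and>
     (\<forall>i\<in>{1..n}. q i \<in> P) \<and>
     inj_on q {1..n} \<and>
     (\<forall>i\<in>{1..n}. m i > 0) \<and>
     (\<Sum>i\<in>{1..n}. m i *\<^sub>R q i) = 0"

definition potential :: "nat \<Rightarrow> (nat \<Rightarrow> real) \<Rightarrow> (nat \<Rightarrow> real^3) \<Rightarrow> real" where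
  "potential n m q =
     (\<Sum>(i, j)\<in>{(i, j). 1 \<le> i \<and> i < j \<and> j \<le> n}. m i * m j / norm (q i - q j))"

text \<open>The vector \<open>g\<close> below is the gradient of the potential in the position of body \<open>j\<close> alone.
  It is taken in the ambient space; for positions in a common plane through the origin it lies
  in that plane and coincides with the gradient within the plane.\<close>

definition central_config :: "nat \<Rightarrow> (nat \<Rightarrow> real^3) \<Rightarrow> (nat \<Rightarrow> real) \<Rightarrow> bool" where
  "central_config n q m \<longleftrightarrow>
     (\<exists>l::real. \<forall>j\<in>{1..n}. \<exists>g.
        GDERIV (\<lambda>x. potential n m (q(j := x))) (q j) :> g \<and>
        g + l *\<^sub>R m j *\<^sub>R q j = 0)"

definition shell :: "nat \<Rightarrow> (nat \<Rightarrow> real^3) \<Rightarrow> real \<Rightarrow> nat set" where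
  "shell n q r = {i\<in>{1..n}. norm (q i) = r}"

definition balanced :: "nat \<Rightarrow> (nat \<Rightarrow> real^3) \<Rightarrow> (nat \<Rightarrow> real) \<Rightarrow> bool" where
  "balanced n q m \<longleftrightarrow>
     (\<forall>r>0. shell n q r \<noteq> {} \<longrightarrow> (\<Sum>i\<in>shell n q r. m i *\<^sub>R q i) = 0)"

text \<open>No body sits at the origin; this is not the distinctness of the positions, which is part
  of \<open>planar_config\<close>.\<close>

definition collisionless :: "nat \<Rightarrow> (nat \<Rightarrow> real^3) \<Rightarrow> bool" where
  "collisionless n q \<longleftrightarrow> (\<forall>i\<in>{1..n}. q i \<noteq> 0)"

text \<open>Vertices of the quadrilaterals are listed in cyclic order, so \<open>a, c\<close> and \<open>b, d\<close> are the pairs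
  of opposite vertices. Degenerate (collinear) parallelograms are excluded.\<close>

definition parallelogram :: "real^3 \<Rightarrow> real^3 \<Rightarrow> real^3 \<Rightarrow> real^3 \<Rightarrow> bool" where
  "parallelogram a b c d \<longleftrightarrow> b - a = c - d \<and> \<not> collinear {a, b, c}"

definition rhombus :: "real^3 \<Rightarrow> real^3 \<Rightarrow> real^3 \<Rightarrow> real^3 \<Rightarrow> bool" where
  "rhombus a b c d \<longleftrightarrow> parallelogram a b c d \<and> dist a b = dist b c"

definition square :: "real^3 \<Rightarrow> real^3 \<Rightarrow> real^3 \<Rightarrow> real^3 \<Rightarrow> bool" where
  "square a b c d \<longleftrightarrow> rhombus a b c d \<and> orthogonal (b - a) (d - a)"

definition antipodal_pairs :: "(nat \<Rightarrow> real^3) \<Rightarrow> (nat \<Rightarrow> real) \<Rightarrow> bool" where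
  "antipodal_pairs q m \<longleftrightarrow> q 1 = - q 3 \<and> q 2 = - q 4 \<and> m 1 = m 3 \<and> m 2 = m 4"

definition type_CCcl :: "(nat \<Rightarrow> real^3) \<Rightarrow> (nat \<Rightarrow> real) \<Rightarrow> bool" where
  "type_CCcl q m \<longleftrightarrow> collinear {q 1, q 2, q 3, q 4}"

definition type_CCr :: "(nat \<Rightarrow> real^3) \<Rightarrow> (nat \<Rightarrow> real) \<Rightarrow> bool" where
  "type_CCr q m \<longleftrightarrow>
     rhombus (q 1) (q 2) (q 3) (q 4) \<and> norm (q 1 - q 3) < norm (q 2 - q 4) \<and> m 1 > m 2"

definition type_CCs :: "(nat \<Rightarrow> real^3) \<Rightarrow> (nat \<Rightarrow> real) \<Rightarrow> bool" where
  "type_CCs q m \<longleftrightarrow>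
     square (q 1) (q 2) (q 3) (q 4) \<and> m 1 = m 2 \<and> m 2 = m 3 \<and> m 3 = m 4"

end

theory Submission
  imports Defs
begin

text \<open>A shell of a balanced collisionless configuration cannot consist of one body, so there are
  either two shells of two bodies, which are antipodal pairs of equal masses, or all four bodies lie
  on one circle about the center of mass.

  On a circle, the radial components of the equations of motion say that \<open>\<Sum>j. m j / d i j\<close> does not
  depend on \<open>i\<close>, and neither does \<open>\<Sum>j. m j * (d i j)\<^sup>2\<close> because of the center of mass. Comparing
  two bodies in both sums shows that the three pairs of opposite edges of the complete graph are
  linearly ordered by length. If all three lengths differed strictly, the tangential components for
  the two ends of a longest edge would give contradictory comparisons of the masses of the other two
  bodies. Hence four of the edges have equal length, and in a plane this forces antipodal pairs.

  For antipodal pairs \<open>\<plusminus>a\<close>, \<open>\<plusminus>b\<close> with independent \<open>a\<close>, \<open>b\<close>, comparing coefficients gives \<open>a \<bullet> b = 0\<close> and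
  \<open>m\<^sub>1 (1/s\<^sup>3 - 1/(2|a|)\<^sup>3) = m\<^sub>2 (1/s\<^sup>3 - 1/(2|b|)\<^sup>3)\<close> with \<open>s = |a - b|\<close>;
  since \<open>s\<close> is less than the longer diagonal, the shorter one carries the heavier bodies.\<close>

section \<open>The gradient of the potential\<close>

lemma gderiv_unique:
  assumes "GDERIV f x :> a" and "GDERIV f x :> b"
  shows "a = b"
proof -
  have "(\<lambda>h. inner h a) = (\<lambda>h. inner h b)"
    using assms has_derivative_unique unfolding gderiv_def by blast
  then show ?thesis
    by (metis inner_commute vector_eq_ldot)
qed

lemma gderiv_sum:
  assumes "\<And>i. i \<in> I \<Longrightarrow> GDERIV (f i) x :> g i"
  shows "GDERIV (\<lambda>x. \<Sum>i\<in>I. f i x) x :> (\<Sum>i\<in>I. g i)"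
  using assms unfolding gderiv_def inner_sum_right by (rule has_derivative_sum)

lemma gderiv_inverse_distance:
  fixes a x :: "'a::real_inner"
  assumes "x \<noteq> a"
  shows "GDERIV (\<lambda>y. c / norm (a - y)) x :> (c / norm (a - x) ^ 3) *\<^sub>R (a - x)"
proof -
  have "GDERIV norm (a - x) :> sgn (a - x)"
    using assms GDERIV_norm by (metis right_minus_eq)
  then have "((\<lambda>y. norm (a - y)) has_derivative (\<lambda>h. inner (- h) (sgn (a - x)))) (at x)"
    unfolding gderiv_def
    by (rule has_derivative_compose[rotated]) (auto intro!: derivative_eq_intros)
  then have "GDERIV (\<lambda>y. norm (a - y)) x :> - sgn (a - x)"
    unfolding gderiv_def by simp
  moreover have "DERIV (\<lambda>t. c / t) (norm (a - x)) :> - c / norm (a - x) ^ 2"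
    using assms by (auto intro!: derivative_eq_intros simp: power2_eq_square)
  ultimately have "GDERIV (\<lambda>y. c / norm (a - y)) x
      :> (- c / norm (a - x) ^ 2) *\<^sub>R (- sgn (a - x))"
    by (rule GDERIV_DERIV_compose)
  then show ?thesis
    by (rule GDERIV_subst) (simp add: sgn_div_norm divide_simps power2_eq_square power3_eq_cube)
qed

text \<open>Only the pairs containing \<open>j\<close> depend on \<open>x\<close>; the others form a
  constant with zero gradient.\<close>

lemma potential_update:
  assumes "j \<in> {1..n}"
  shows "potential n m (q(j := x)) =
    (\<Sum>(i, k)\<in>{(i, k). 1 \<le> i \<and> i < k \<and> k \<le> n \<and> i \<noteq> j \<and> k \<noteq> j}.
       m i * m k / norm (q i - q k)) +
    (\<Sum>i\<in>{1..n} - {j}. m i * m j / norm (q i - x))"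
proof -
  define A where "A = {(i, k). 1 \<le> i \<and> i < k \<and> k \<le> n \<and> i \<noteq> j \<and> k \<noteq> j}"
  define B where "B = {(i, k). 1 \<le> i \<and> i < k \<and> k \<le> n \<and> (i = j \<or> k = j)}"
  define p where "p = q(j := x)"
  let ?f = "\<lambda>(i, k). m i * m k / norm (p i - p k)"
  have fin: "finite A" "finite B"
    unfolding A_def B_def by (auto intro: finite_subset[of _ "{1..n} \<times> {1..n}"])
  have "{(i, k). 1 \<le> i \<and> i < k \<and> k \<le> n} = A \<union> B"
    unfolding A_def B_def by auto
  then have "potential n m p = sum ?f A + sum ?f B"
    unfolding potential_def using fin
    by (simp add: sum.union_disjoint A_def B_def disjoint_iff)
  moreover have "sum ?f A = (\<Sum>(i, k)\<in>A. m i * m k / norm (q i - q k))"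
    by (rule sum.cong) (auto simp: A_def p_def)
  \<comment> \<open>A pair containing \<open>j\<close> is determined by its other member;
    \<open>min\<close> and \<open>max\<close> restore the increasing order.\<close>
  moreover have "sum ?f B = (\<Sum>i\<in>{1..n} - {j}. m i * m j / norm (q i - x))"
    by (rule sum.reindex_bij_witness[of _ "\<lambda>i. (min i j, max i j)" "\<lambda>(i, k). if i = j then k else i"])
      (use assms in \<open>auto simp: B_def p_def min_def max_def norm_minus_commute mult.commute\<close>)
  ultimately show ?thesis
    unfolding A_def p_def by simp
qed

lemma gderiv_potential:
  assumes "j \<in> {1..n}" and "inj_on q {1..n}"
  shows "GDERIV (\<lambda>x. potential n m (q(j := x))) (q j)
    :> (\<Sum>i\<in>{1..n} - {j}. (m i * m j / norm (q i - q j) ^ 3) *\<^sub>R (q i - q j))"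
proof -
  have "GDERIV (\<lambda>x. \<Sum>i\<in>{1..n} - {j}. m i * m j / norm (q i - x)) (q j)
    :> (\<Sum>i\<in>{1..n} - {j}. (m i * m j / norm (q i - q j) ^ 3) *\<^sub>R (q i - q j))"
    using assms by (intro gderiv_sum gderiv_inverse_distance) (auto dest: inj_onD)
  from GDERIV_add[OF GDERIV_const this] show ?thesis
    by (simp add: potential_update[OF assms(1)])
qed

text \<open>Uniqueness of gradients replaces the existential \<open>g\<close> by the explicit
  attraction, and the positive factor \<open>m j\<close> is cancelled. Later sections work with
  these vector equations instead of derivatives.\<close>

lemma central_config_equations:
  assumes "planar_config P n q m" and "central_config n q m"
  obtains l where "\<And>j. j \<in> {1..n} \<Longrightarrow>
    (\<Sum>i\<in>{1..n} - {j}. (m i / norm (q i - q j) ^ 3) *\<^sub>R (q i - q j)) + l *\<^sub>R q j = 0"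
proof -
  have inj: "inj_on q {1..n}" and pos: "\<And>i. i \<in> {1..n} \<Longrightarrow> m i > 0"
    using assms(1) unfolding planar_config_def by auto
  obtain l where l: "\<And>j. j \<in> {1..n} \<Longrightarrow> \<exists>g. GDERIV (\<lambda>x. potential n m (q(j := x))) (q j) :> g \<and>
      g + l *\<^sub>R m j *\<^sub>R q j = 0"
    using assms(2) unfolding central_config_def by blast
  show thesis
  proof
    fix j assume j: "j \<in> {1..n}"
    let ?s = "\<Sum>i\<in>{1..n} - {j}. (m i / norm (q i - q j) ^ 3) *\<^sub>R (q i - q j)"
    have "(\<Sum>i\<in>{1..n} - {j}. (m i * m j / norm (q i - q j) ^ 3) *\<^sub>R (q i - q j)) = m j *\<^sub>R ?s"
      unfolding scaleR_sum_right by (rule sum.cong) (auto simp: mult.commute)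
    then have "m j *\<^sub>R ?s + l *\<^sub>R m j *\<^sub>R q j = 0"
      using l[OF j] gderiv_unique[OF gderiv_potential[OF j inj]] by auto
    then have "m j *\<^sub>R (?s + l *\<^sub>R q j) = 0"
      by (simp add: scaleR_add_right mult.commute)
    then show "?s + l *\<^sub>R q j = 0"
      using pos[OF j] by simp
  qed
qed

section \<open>Four bodies on a circle\<close>

text \<open>Three nonzero pairwise orthogonal vectors would be independent, too many for a plane.
  The dimension matters: in space, equal masses at the vertices of a regular tetrahedron form a
  balanced central configuration without antipodal pairs.\<close>

lemma orthogonal_in_plane_eq_0:
  fixes u v w :: "'a::euclidean_space"
  assumes "subspace P" "dim P = 2" "u \<in> P" "v \<in> P" "w \<in> P"
    and "u \<noteq> 0" "v \<noteq> 0" "u \<bullet> v = 0" "u \<bullet> w = 0" "v \<bullet> w = 0"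
  shows "w = 0"
proof (rule ccontr)
  assume "w \<noteq> 0"
  have "pairwise orthogonal {u, v, w}"
    using assms by (auto simp: pairwise_def orthogonal_def inner_commute)
  then have "independent {u, v, w}"
    using assms \<open>w \<noteq> 0\<close> by (intro pairwise_orthogonal_independent) auto
  moreover have "{u, v, w} \<subseteq> P"
    using assms by auto
  ultimately have "card {u, v, w} \<le> 2"
    using independent_card_le_dim assms(2) by metis
  moreover have "u \<noteq> v" "u \<noteq> w" "v \<noteq> w"
    using assms \<open>w \<noteq> 0\<close> by auto
  ultimately show False
    by simp
qed

lemma inner_equal_norms:
  fixes x y :: "'a::real_inner"
  assumes "norm x = R" "norm y = R"
  shows "x \<bullet> y = R\<^sup>2 - (norm (x - y))\<^sup>2 / 2"
  using dot_norm_neg[of x y] assms by (simp add: field_simps)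

text \<open>For three points on a sphere about the origin, the components of \<open>a *\<^sub>R x\<close> and \<open>b *\<^sub>R y\<close>
  orthogonal to \<open>z\<close> cancel, hence have the same length.\<close>

lemma orthogonal_components_eq:
  fixes x y z :: "'a::real_inner"
  assumes "norm x = R" "norm y = R" "norm z = R" and eq: "a *\<^sub>R x + b *\<^sub>R y = c *\<^sub>R z"
  shows "a\<^sup>2 * (R ^ 4 - (x \<bullet> z)\<^sup>2) = b\<^sup>2 * (R ^ 4 - (y \<bullet> z)\<^sup>2)"
proof -
  have R: "x \<bullet> x = R\<^sup>2" "y \<bullet> y = R\<^sup>2" "z \<bullet> z = R\<^sup>2"
    using assms by (auto simp: dot_square_norm)
  have x: "a *\<^sub>R x = c *\<^sub>R z - b *\<^sub>R y"
    using eq by (simp add: algebra_simps)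
  have "(a *\<^sub>R x) \<bullet> (a *\<^sub>R x) = (c *\<^sub>R z - b *\<^sub>R y) \<bullet> (c *\<^sub>R z - b *\<^sub>R y)"
    unfolding x ..
  then have 1: "a\<^sup>2 * R\<^sup>2 = c\<^sup>2 * R\<^sup>2 - 2 * b * c * (y \<bullet> z) + b\<^sup>2 * R\<^sup>2"
    by (simp add: R inner_diff_left inner_diff_right inner_commute power2_eq_square algebra_simps)
  have "(a *\<^sub>R x) \<bullet> z = (c *\<^sub>R z - b *\<^sub>R y) \<bullet> z"
    unfolding x ..
  then have 2: "a * (x \<bullet> z) = c * R\<^sup>2 - b * (y \<bullet> z)"
    by (simp add: R inner_diff_left)
  have "a\<^sup>2 * (R ^ 4 - (x \<bullet> z)\<^sup>2) = (a\<^sup>2 * R\<^sup>2) * R\<^sup>2 - (a * (x \<bullet> z))\<^sup>2"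
    by (simp add: algebra_simps power2_eq_square power4_eq_xxxx)
  also have "\<dots> = b\<^sup>2 * (R ^ 4 - (y \<bullet> z)\<^sup>2)"
    unfolding 1 2 by (simp add: algebra_simps power2_eq_square power4_eq_xxxx)
  finally show ?thesis .
qed

text \<open>Here \<open>b\<close>, \<open>b'\<close> and \<open>c\<close>, \<open>c'\<close> stand
  for the two pairs of opposite sides of a 4-cycle. The first two hypotheses compare the ends of one
  diagonal, the last two those of the other. If \<open>b < c'\<close>, the former force
  \<open>b' < c\<close>, and then the latter exclude \<open>c \<le> b\<close> and
  \<open>c' \<le> b'\<close>.\<close>

lemma crossing_order:
  fixes b b' c c' :: "'a::linorder"
  assumes "c' \<le> b \<Longrightarrow> b' \<le> c \<Longrightarrow> c' = b \<and> b' = c"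
    and "b \<le> c' \<Longrightarrow> c \<le> b' \<Longrightarrow> b = c' \<and> c = b'"
    and "c \<le> b \<Longrightarrow> b' \<le> c' \<Longrightarrow> c = b \<and> b' = c'"
    and "b \<le> c \<Longrightarrow> c' \<le> b' \<Longrightarrow> b = c \<and> c' = b'"
  shows "(b = c \<and> b' = c \<and> c' = c) \<or> max b b' < min c c' \<or> max c c' < min b b'"
proof -
  consider "b < c'" | "b = c'" | "c' < b"
    by (rule linorder_cases)
  then show ?thesis
  proof cases
    case 1
    then have "b' < c"
      using assms(2) by force
    moreover have "b < c \<and> b' < c'"
      using 1 \<open>b' < c\<close> assms(3,4) by (metis linear order_le_less not_le order.strict_trans)
    ultimately show ?thesis
      using 1 by simp
  next
    case 2
    then have "b' = c"
      using assms(1,2) by (metis linear order_refl)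
    then show ?thesis
      using 2 assms(3,4) by (metis linear)
  next
    case 3
    then have "c < b'"
      using assms(1) by force
    moreover have "c < b \<and> c' < b'"
      using 3 \<open>c < b'\<close> assms(3,4) by (metis linear order_le_less not_le order.strict_trans)
    ultimately show ?thesis
      using 3 by simp
  qed
qed

text \<open>The equations are symmetric in the bodies, so each fact is proved for an arbitrary
  naming and reused with the names permuted.\<close>

definition labelling :: "nat \<Rightarrow> nat \<Rightarrow> nat \<Rightarrow> nat \<Rightarrow> bool" where
  "labelling i j k l \<longleftrightarrow> distinct [i, j, k, l] \<and> {i, j, k, l} = {1..4}"

lemma labelling_perms:
  assumes "labelling i j k l"
  shows "labelling j i k l" "labelling i k j l" "labelling i j l k"
  using assms unfolding labelling_def by auto

section \<open>The equations for arbitrarily named bodies\<close>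

locale planar_cc4 =
  fixes P :: "(real^3) set" and q :: "nat \<Rightarrow> real^3" and m :: "nat \<Rightarrow> real" and \<mu> :: real
  assumes config: "planar_config P 4 q m"
    and cc: "j \<in> {1..4} \<Longrightarrow>
      (\<Sum>i\<in>{1..4} - {j}. (m i / norm (q i - q j) ^ 3) *\<^sub>R (q i - q j)) + \<mu> *\<^sub>R q j = 0"
begin

definition d :: "nat \<Rightarrow> nat \<Rightarrow> real" where
  "d i j = norm (q i - q j)"

lemma d_commute: "d i j = d j i"
  by (simp add: d_def norm_minus_commute)

context
  fixes i j k l
  assumes lab: "labelling i j k l"
begin

lemma bodies: "i \<in> {1..4}" "j \<in> {1..4}" "k \<in> {1..4}" "l \<in> {1..4}"
  using lab unfolding labelling_def by blast+

lemma mass_pos: "m i > 0" "m j > 0" "m k > 0" "m l > 0"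
  using config bodies unfolding planar_config_def by auto

lemma d_pos: "d i j > 0"
  using config bodies lab unfolding planar_config_def labelling_def d_def
  by (auto dest: inj_onD)

lemma center_of_mass: "m i *\<^sub>R q i + m j *\<^sub>R q j + m k *\<^sub>R q k + m l *\<^sub>R q l = 0"
proof -
  have "(\<Sum>i\<in>{1..4}. m i *\<^sub>R q i) = 0"
    using config unfolding planar_config_def by blast
  moreover have "{1..4} = {i, j, k, l}" "distinct [i, j, k, l]"
    using lab unfolding labelling_def by auto
  ultimately show ?thesis
    by (simp only: distinct.simps) (simp add: add.assoc)
qed

lemma cc_equation:
  "(m j / d i j ^ 3) *\<^sub>R (q j - q i) + (m k / d i k ^ 3) *\<^sub>R (q k - q i) +
   (m l / d i l ^ 3) *\<^sub>R (q l - q i) + \<mu> *\<^sub>R q i = 0"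
proof -
  have "{1..4} - {i} = {j, k, l}"
    using lab unfolding labelling_def by auto
  then show ?thesis
    using cc[OF bodies(1)] lab unfolding labelling_def
    by (simp add: d_def norm_minus_commute add.assoc)
qed

end

end

section \<open>All bodies on one circle about the center of mass\<close>

locale planar_cc4_circle = planar_cc4 +
  fixes R :: real
  assumes circle: "i \<in> {1..4} \<Longrightarrow> norm (q i) = R"
begin

lemma inner_circle:
  assumes "i \<in> {1..4}" "j \<in> {1..4}"
  shows "q i \<bullet> q j = R\<^sup>2 - (d i j)\<^sup>2 / 2"
  using inner_equal_norms circle assms unfolding d_def by blast

lemma inner_self:
  assumes "i \<in> {1..4}"
  shows "q i \<bullet> q i = R\<^sup>2"
  using circle[OF assms] by (simp add: dot_square_norm)

context
  fixes i j k l
  assumes lab: "labelling i j k l"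
begin

text \<open>Inner product of the center of mass relation with \<open>q i\<close>; equal norms turn
  inner products into squared distances. The right-hand side is the same for every body.\<close>

lemma sum_squares:
  "m j * (d i j)\<^sup>2 + m k * (d i k)\<^sup>2 + m l * (d i l)\<^sup>2 = 2 * (m i + m j + m k + m l) * R\<^sup>2"
proof -
  have "(m i *\<^sub>R q i + m j *\<^sub>R q j + m k *\<^sub>R q k + m l *\<^sub>R q l) \<bullet> q i = 0"
    unfolding center_of_mass[OF lab] by simp
  then have "m i * R\<^sup>2 + m j * (R\<^sup>2 - (d i j)\<^sup>2 / 2) + m k * (R\<^sup>2 - (d i k)\<^sup>2 / 2) +
      m l * (R\<^sup>2 - (d i l)\<^sup>2 / 2) = 0"
    using bodies[OF lab] by (simp add: inner_add_left inner_self inner_circle d_commute)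
  then show ?thesis
    by (simp add: field_simps)
qed

text \<open>The radial component of the equation of \<open>i\<close>: on the circle
  \<open>(q b - q i) \<bullet> q i\<close> is \<open>- (d i b)\<^sup>2 / 2\<close>, which reduces
  the inverse cube to an inverse distance. Again the right-hand side does not depend on the
  body.\<close>

lemma sum_inverses: "m j / d i j + m k / d i k + m l / d i l = 2 * \<mu> * R\<^sup>2"
proof -
  have inner_term: "((m b / d i b ^ 3) *\<^sub>R (q b - q i)) \<bullet> q i = - (m b / d i b) / 2"
    if "b \<in> {1..4}" "d i b > 0" for b
  proof -
    have "(q b - q i) \<bullet> q i = - (d i b)\<^sup>2 / 2"
      using inner_circle[OF that(1) bodies(1)[OF lab]] inner_self[OF bodies(1)[OF lab]] d_commute[of b i]
      by (simp add: inner_diff_left)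
    then show ?thesis
      using that by (simp add: power2_eq_square power3_eq_cube)
  qed
  have pos: "d i j > 0" "d i k > 0" "d i l > 0"
    using d_pos lab labelling_perms by blast+
  note inner_terms = inner_term[OF bodies(2)[OF lab] pos(1)] inner_term[OF bodies(3)[OF lab] pos(2)]
    inner_term[OF bodies(4)[OF lab] pos(3)]
  have "((m j / d i j ^ 3) *\<^sub>R (q j - q i) + (m k / d i k ^ 3) *\<^sub>R (q k - q i) +
      (m l / d i l ^ 3) *\<^sub>R (q l - q i) + \<mu> *\<^sub>R q i) \<bullet> q i = 0"
    unfolding cc_equation[OF lab] by simp
  then have "- (m j / d i j) / 2 - (m k / d i k) / 2 - (m l / d i l) / 2 + \<mu> * R\<^sup>2 = 0"
    unfolding inner_add_left inner_terms inner_scaleR_left[of \<mu>] inner_self[OF bodies(1)[OF lab]]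
    by simp
  moreover have "x + y + z = 2 * t" if "- x / 2 - y / 2 - z / 2 + t = 0" for x y z t :: real
    using that by linarith
  ultimately show ?thesis
    unfolding mult.assoc by blast
qed

end

text \<open>Comparing the equations of two bodies, the squares of the distances ask that the body
  farther from the other two be the heavier one, the inverse distances that it be the lighter one.\<close>

lemma no_farther_body:
  assumes lab: "labelling i j k l" and le: "d j k \<le> d i k" "d j l \<le> d i l"
  shows "d j k = d i k \<and> d j l = d i l"
proof -
  have lab': "labelling j i k l"
    using lab labelling_perms by blast
  have pos: "d i j > 0" "d j k > 0" "d j l > 0"
    using d_pos lab labelling_perms by blast+
  note mpos = mass_pos[OF lab]
  have "(m i - m j) * (d i j)\<^sup>2 = m k * ((d i k)\<^sup>2 - (d j k)\<^sup>2) + m l * ((d i l)\<^sup>2 - (d j l)\<^sup>2)"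
    using sum_squares[OF lab] sum_squares[OF lab'] d_commute[of j i] by (simp add: algebra_simps)
  moreover have "m k * ((d i k)\<^sup>2 - (d j k)\<^sup>2) \<ge> 0" "m l * ((d i l)\<^sup>2 - (d j l)\<^sup>2) \<ge> 0"
    using mpos le pos by (auto intro!: mult_nonneg_nonneg power_mono)
  ultimately have "m i - m j \<ge> 0"
    using pos by (metis add_nonneg_nonneg zero_le_mult_iff zero_less_power not_le)
  have inv: "m k * (1 / d j k - 1 / d i k) + m l * (1 / d j l - 1 / d i l) = (m j - m i) / d i j"
    using sum_inverses[OF lab] sum_inverses[OF lab'] d_commute[of j i]
    by (simp add: algebra_simps diff_divide_distrib)
  have "(m j - m i) / d i j \<le> 0"
    using \<open>m i - m j \<ge> 0\<close> pos by (simp add: divide_nonpos_pos)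
  moreover have "m k * (1 / d j k - 1 / d i k) \<ge> 0" "m l * (1 / d j l - 1 / d i l) \<ge> 0"
    using mpos le pos by (auto intro!: mult_nonneg_nonneg simp: frac_le)
  ultimately have "m k * (1 / d j k - 1 / d i k) = 0" "m l * (1 / d j l - 1 / d i l) = 0"
    using inv by linarith+
  then show ?thesis
    using mpos by auto
qed

text \<open>In the 4-cycle \<open>i\<close>, \<open>j\<close>, \<open>k\<close>, \<open>l\<close>,
  applying \<open>no_farther_body\<close> to the ends of each diagonal in both directions supplies
  the hypotheses of \<open>crossing_order\<close>.\<close>

lemma opposite_pairs_comparable:
  assumes lab: "labelling i j k l"
  shows "(d i j = d i l \<and> d k l = d i l \<and> d j k = d i l) \<or>
    max (d i j) (d k l) < min (d i l) (d j k) \<or> max (d i l) (d j k) < min (d i j) (d k l)"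
proof -
  have perms: "labelling i k j l" "labelling k i j l" "labelling i k l j" "labelling k i l j"
      "labelling j l i k" "labelling l j i k" "labelling j l k i" "labelling l j k i"
    using lab unfolding labelling_def by auto
  note commute = d_commute[of k j] d_commute[of l i] d_commute[of l k] d_commute[of j i]
  note no_farther = perms[THEN no_farther_body, unfolded commute]
  show ?thesis
    by (rule crossing_order) (use no_farther in blast)+
qed

text \<open>Subtracting \<open>\<kappa>\<close> times the center of mass relation removes the opposite body \<open>k\<close> from the
  equation of body \<open>i\<close>; what is left is compared orthogonally to \<open>q i\<close>.\<close>

lemma tangential_equation:
  assumes lab: "labelling i j k l"
  defines "\<kappa> \<equiv> 1 / d i k ^ 3"
  defines "G \<equiv> \<lambda>x. (x * (1 / x ^ 3 - \<kappa>))\<^sup>2 * (R\<^sup>2 - x\<^sup>2 / 4)"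
  shows "(m j)\<^sup>2 * G (d i j) = (m l)\<^sup>2 * G (d i l)"
proof -
  let ?a = "m j * (1 / d i j ^ 3 - \<kappa>)" and ?b = "m l * (1 / d i l ^ 3 - \<kappa>)"
  have "\<kappa> * m k = m k / d i k ^ 3"
    by (simp add: \<kappa>_def)
  then have "?a *\<^sub>R q j + ?b *\<^sub>R q l -
      (m j / d i j ^ 3 + m k / d i k ^ 3 + m l / d i l ^ 3 - \<mu> + \<kappa> * m i) *\<^sub>R q i =
    ((m j / d i j ^ 3) *\<^sub>R (q j - q i) + (m k / d i k ^ 3) *\<^sub>R (q k - q i) +
      (m l / d i l ^ 3) *\<^sub>R (q l - q i) + \<mu> *\<^sub>R q i) -
    \<kappa> *\<^sub>R (m i *\<^sub>R q i + m j *\<^sub>R q j + m k *\<^sub>R q k + m l *\<^sub>R q l)"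
    by (simp add: scaleR_add_right scaleR_diff_right scaleR_add_left scaleR_diff_left
        right_diff_distrib mult.commute[of \<kappa>])
  then have "?a *\<^sub>R q j + ?b *\<^sub>R q l =
      (m j / d i j ^ 3 + m k / d i k ^ 3 + m l / d i l ^ 3 - \<mu> + \<kappa> * m i) *\<^sub>R q i"
    unfolding cc_equation[OF lab] center_of_mass[OF lab] by simp
  then have "?a\<^sup>2 * (R ^ 4 - (q j \<bullet> q i)\<^sup>2) = ?b\<^sup>2 * (R ^ 4 - (q l \<bullet> q i)\<^sup>2)"
    by (rule orthogonal_components_eq[rotated 3]) (use bodies[OF lab] circle in auto)
  \<comment> \<open>The Gram determinant of \<open>q b\<close> and \<open>q i\<close>, that is,
    \<open>R\<^sup>2\<close> times the squared component of \<open>q b\<close> orthogonal to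
    \<open>q i\<close>. Its factor \<open>(d i b)\<^sup>2\<close> goes into the square in
    \<open>G\<close>.\<close>
  moreover have "R ^ 4 - (q b \<bullet> q i)\<^sup>2 = (d i b)\<^sup>2 * (R\<^sup>2 - (d i b)\<^sup>2 / 4)" if "b \<in> {1..4}" for b
    using that bodies[OF lab] unfolding inner_circle[OF that bodies(1)[OF lab]] d_commute[of b]
    by (simp add: power2_eq_square power4_eq_xxxx field_simps)
  ultimately show ?thesis
    using bodies[OF lab] by (simp add: G_def power_mult_distrib mult_ac)
qed

text \<open>The ends \<open>i\<close> and \<open>k\<close> of a diagonal share the same
  \<open>\<kappa>\<close>, hence the same function \<open>G\<close>, which decreases below
  \<open>d i k\<close>. Body \<open>i\<close> is nearer to \<open>j\<close> than to
  \<open>l\<close>, so its tangential equation makes \<open>l\<close> the heavier of the two; body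
  \<open>k\<close> is nearer to \<open>l\<close>, so its equation makes \<open>j\<close> the heavier
  one.\<close>

lemma opposite_pairs_not_strict:
  assumes lab: "labelling i j k l"
    and le: "max (d i j) (d k l) < min (d i l) (d j k)"
      "max (d i l) (d j k) < min (d i k) (d j l)"
  shows False
proof -
  define \<kappa> where "\<kappa> = 1 / d i k ^ 3"
  define G where "G x = (x * (1 / x ^ 3 - \<kappa>))\<^sup>2 * (R\<^sup>2 - x\<^sup>2 / 4)" for x
  have "labelling k j i l"
    using lab unfolding labelling_def by auto
  have i: "(m j)\<^sup>2 * G (d i j) = (m l)\<^sup>2 * G (d i l)"
    using tangential_equation[OF lab] unfolding G_def \<kappa>_def .
  have k: "(m j)\<^sup>2 * G (d j k) = (m l)\<^sup>2 * G (d k l)"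
    using tangential_equation[OF \<open>labelling k j i l\<close>] unfolding G_def \<kappa>_def
    by (simp add: d_commute)
  \<comment> \<open>Both factors of \<open>G\<close> decrease:
    \<open>1 / z\<^sup>2 - \<kappa> * z\<close> is positive as long as \<open>z < d i k\<close>, and
    \<open>R\<^sup>2 - z\<^sup>2 / 4\<close> is nonnegative because a chord is at most a
    diameter.\<close>
  have mono: "G y < G x \<and> 0 \<le> G y" if "0 < x" "x < y" "y < d i k" "y \<le> 2 * R" for x y
  proof -
    have f: "z * (1 / z ^ 3 - \<kappa>) = 1 / z\<^sup>2 - \<kappa> * z" if "z > 0" for z
      using that by (simp add: field_simps power2_eq_square power3_eq_cube)
    have "\<kappa> > 0" "\<kappa> < 1 / y ^ 3"
      using that unfolding \<kappa>_def by (auto intro!: divide_strict_left_mono power_strict_mono)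
    then have "0 < y * (1 / y ^ 3 - \<kappa>)"
      using that by simp
    moreover have "1 / y\<^sup>2 < 1 / x\<^sup>2"
      using that by (intro divide_strict_left_mono power_strict_mono) auto
    then have "y * (1 / y ^ 3 - \<kappa>) < x * (1 / x ^ 3 - \<kappa>)"
      using that \<open>\<kappa> > 0\<close> by (simp add: f mult_strict_left_mono diff_strict_mono)
    ultimately have "(y * (1 / y ^ 3 - \<kappa>))\<^sup>2 < (x * (1 / x ^ 3 - \<kappa>))\<^sup>2"
      by (intro power_strict_mono) auto
    moreover have "x\<^sup>2 < y\<^sup>2" "y\<^sup>2 \<le> (2 * R)\<^sup>2"
      using that by (intro power_strict_mono power_mono; simp)+
    then have "0 \<le> R\<^sup>2 - y\<^sup>2 / 4" "R\<^sup>2 - y\<^sup>2 / 4 < R\<^sup>2 - x\<^sup>2 / 4"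
      by (auto simp: power_mult_distrib)
    ultimately show ?thesis
      unfolding G_def by (auto intro!: mult_strict_mono')
  qed
  have diam: "d a b \<le> 2 * R" if "a \<in> {1..4}" "b \<in> {1..4}" for a b
    using norm_triangle_ineq4[of "q a" "q b"] circle that unfolding d_def by fastforce
  have pos: "d i j > 0" "d k l > 0"
    using d_pos[OF lab] d_pos[of k l i j] lab unfolding labelling_def by auto
  have 1: "G (d i l) < G (d i j)" "0 \<le> G (d i l)"
    using mono[of "d i j" "d i l"] le pos diam bodies[OF lab] by auto
  have 2: "G (d j k) < G (d k l)" "0 \<le> G (d j k)"
    using mono[of "d k l" "d j k"] le pos diam bodies[OF lab] by auto
  have m: "(m j)\<^sup>2 > 0" "(m l)\<^sup>2 > 0"
    using mass_pos[OF lab] by auto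
  have "(m j)\<^sup>2 < (m l)\<^sup>2"
  proof (rule ccontr)
    assume "\<not> ?thesis"
    then have "(m l)\<^sup>2 * G (d i l) \<le> (m j)\<^sup>2 * G (d i l)"
      using 1 by (intro mult_right_mono) auto
    then show False
      using i 1 m mult_strict_left_mono[of "G (d i l)" "G (d i j)" "(m j)\<^sup>2"] by linarith
  qed
  then have "(m j)\<^sup>2 * G (d j k) \<le> (m l)\<^sup>2 * G (d j k)"
    using 2 by (intro mult_right_mono) auto
  then show False
    using k 2 m mult_strict_left_mono[of "G (d j k)" "G (d k l)" "(m l)\<^sup>2"] by linarith
qed

text \<open>If no two of the three pairs of opposite edges had all lengths equal, any two pairs
  would be strictly comparable, and three such comparisons always contain a strict chain, which is
  impossible.\<close>

lemma equal_sides: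
  obtains i j k l where "labelling i j k l" "d i j = d i l" "d k l = d i l" "d j k = d i l"
proof -
  define eq where "eq i j k l \<longleftrightarrow> d i j = d i l \<and> d k l = d i l \<and> d j k = d i l" for i j k l
  define lt where "lt i j k l \<longleftrightarrow> max (d i j) (d k l) < min (d i l) (d j k)" for i j k l
  have comp: "eq i j k l \<or> lt i j k l \<or> lt i l k j" if "labelling i j k l" for i j k l
    using opposite_pairs_comparable[OF that] unfolding eq_def lt_def by (auto simp: d_commute)
  have strict: "lt i j k l \<Longrightarrow> lt i l j k \<Longrightarrow> False" if "labelling i j k l" for i j k l
    using opposite_pairs_not_strict[OF that] unfolding lt_def by (auto simp: d_commute)
  \<comment> \<open>With body 1 first, these six namings correspond to the six possible chains of
    the three pairs of opposite edges; the first three namings provide the pairwise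
    comparisons.\<close>
  have labs: "labelling 1 2 3 4" "labelling 1 2 4 3" "labelling 1 3 2 4" "labelling 1 3 4 2"
      "labelling 1 4 2 3" "labelling 1 4 3 2"
    unfolding labelling_def by auto
  have "\<exists>i j k l. labelling i j k l \<and> eq i j k l"
    using comp[OF labs(1)] comp[OF labs(2)] comp[OF labs(3)] strict[OF labs(1)] strict[OF labs(2)]
      strict[OF labs(3)] strict[OF labs(4)] strict[OF labs(5)] strict[OF labs(6)] labs
    by blast
  then show thesis
    using that unfolding eq_def by blast
qed

text \<open>Equal sides make the diagonals \<open>q i - q k\<close> and \<open>q j - q l\<close>
  orthogonal to each other and to both sums \<open>q i + q k\<close> and \<open>q j + q l\<close>;
  in a plane these sums must vanish.\<close>

lemma circle_antipodal:
  obtains i j k l where "labelling i j k l" "q i = - q k" "q j = - q l" "m i = m k" "m j = m l"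
proof -
  obtain i j k l where lab: "labelling i j k l"
    and eq: "d i j = d i l" "d k l = d i l" "d j k = d i l"
    using equal_sides .
  note in4 = bodies[OF lab]
  have P: "subspace P" "dim P = 2" "q i \<in> P" "q j \<in> P" "q k \<in> P" "q l \<in> P"
    using config in4 unfolding planar_config_def by auto
  have ne: "q i - q k \<noteq> 0" "q j - q l \<noteq> 0"
    using config in4 lab unfolding planar_config_def labelling_def by (auto dest: inj_onD)
  have ip: "q i \<bullet> q j = q i \<bullet> q l" "q k \<bullet> q l = q i \<bullet> q l" "q j \<bullet> q k = q i \<bullet> q l"
    using in4 eq by (auto simp: inner_circle)
  have sq: "q i \<bullet> q i = q k \<bullet> q k" "q j \<bullet> q j = q l \<bullet> q l"
    using in4 by (auto simp: inner_self)
  have "q i + q k = 0"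
    by (rule orthogonal_in_plane_eq_0[of P "q i - q k" "q j - q l"])
      (use P ne ip sq in \<open>auto simp: subspace_diff subspace_add inner_diff_left inner_diff_right
        inner_add_left inner_add_right inner_commute\<close>)
  moreover have "q j + q l = 0"
    by (rule orthogonal_in_plane_eq_0[of P "q i - q k" "q j - q l"])
      (use P ne ip sq in \<open>auto simp: subspace_diff subspace_add inner_diff_left inner_diff_right
        inner_add_left inner_add_right inner_commute\<close>)
  ultimately have anti: "q i = - q k" "q j = - q l"
    by (auto simp: eq_neg_iff_add_eq_0)
  have com: "m i *\<^sub>R q i + m j *\<^sub>R q j + m k *\<^sub>R q k + m l *\<^sub>R q l = 0"
    by (rule center_of_mass[OF lab])
  \<comment> \<open>Replacing \<open>q i\<close> by \<open>- q k\<close> flips the sign of one of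
    two equal inner products, so the diagonals lie on orthogonal axes. The center of mass relation
    then splits along them and yields the equal masses.\<close>
  have "q k \<bullet> q l = - q k \<bullet> q l"
    using ip(2) unfolding anti(1) .
  then have "q k \<bullet> q l = 0"
    by simp
  then have orth: "q l \<bullet> q k = 0"
    by (simp add: inner_commute)
  have "(m i *\<^sub>R q i + m j *\<^sub>R q j + m k *\<^sub>R q k + m l *\<^sub>R q l) \<bullet> q k = 0"
    "(m i *\<^sub>R q i + m j *\<^sub>R q j + m k *\<^sub>R q k + m l *\<^sub>R q l) \<bullet> q l = 0"
    unfolding com by simp_all
  then have "(m k - m i) * (q k \<bullet> q k) = 0" "(m l - m j) * (q l \<bullet> q l) = 0"
    using \<open>q k \<bullet> q l = 0\<close> orth by (simp_all add: anti inner_add_left algebra_simps)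
  then have "m i = m k" "m j = m l"
    using ne anti by auto
  then show thesis
    using that lab anti by blast
qed

end

section \<open>Antipodal pairs\<close>

text \<open>The difference of \<open>a\<close> and \<open>- a\<close> is a nonzero multiple of
  \<open>a\<close>, so \<open>a\<close> spans the direction \<open>u\<close> of the line.\<close>

lemma collinear_antipodal:
  fixes a b :: "'a::real_vector"
  assumes "collinear {a, b, - a}" "a \<noteq> 0"
  obtains t where "b = t *\<^sub>R a"
proof -
  obtain u where u: "\<And>x y. x \<in> {a, b, - a} \<Longrightarrow> y \<in> {a, b, - a} \<Longrightarrow> \<exists>c. x - y = c *\<^sub>R u"
    using assms(1) unfolding collinear_def by blast
  obtain c c' where c: "a - (- a) = c *\<^sub>R u" and c': "b - a = c' *\<^sub>R u"
    using u[of a "- a"] u[of b a] by auto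
  have "c \<noteq> 0"
  proof
    assume "c = 0"
    then have "2 *\<^sub>R a = 0"
      using c by (simp add: scaleR_2)
    then show False
      using assms(2) by simp
  qed
  have "2 *\<^sub>R a = c *\<^sub>R u"
    using c by (simp add: scaleR_2)
  then have "(1 / c) *\<^sub>R 2 *\<^sub>R a = (1 / c) *\<^sub>R c *\<^sub>R u"
    by simp
  then have u_eq: "u = (2 / c) *\<^sub>R a"
    using \<open>c \<noteq> 0\<close> by simp
  have "b = a + c' *\<^sub>R u"
    using c' by (simp add: algebra_simps)
  then have "b = (1 + c' * (2 / c)) *\<^sub>R a"
    unfolding u_eq by (simp add: scaleR_add_left)
  then show thesis
    using that by blast
qed

lemma collinear_multiples: "collinear {a, t *\<^sub>R a, - a, - (t *\<^sub>R a)}"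
proof -
  have "{a, t *\<^sub>R a, - a, - (t *\<^sub>R a)} \<subseteq> range (\<lambda>c. c *\<^sub>R a)"
    by (auto intro: range_eqI[of _ _ 1] range_eqI[of _ _ "-1"] range_eqI[of _ _ "-t"])
  moreover have "collinear (range (\<lambda>c. c *\<^sub>R a))"
    unfolding collinear_def by (auto intro!: exI[of _ a] simp flip: scaleR_diff_left)
  ultimately show ?thesis
    using collinear_subset by blast
qed

lemma not_multiple_imp_independent:
  fixes a b :: "'a::real_vector"
  assumes "\<And>t. b \<noteq> t *\<^sub>R a" "a \<noteq> 0" and "x *\<^sub>R a + y *\<^sub>R b = 0"
  shows "x = 0 \<and> y = 0"
proof -
  have "y = 0"
  proof (rule ccontr)
    assume "y \<noteq> 0"
    have "y *\<^sub>R b = - x *\<^sub>R a"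
      using assms(3) by (simp add: eq_neg_iff_add_eq_0 add.commute)
    then have "(1 / y) *\<^sub>R y *\<^sub>R b = (1 / y) *\<^sub>R (- x) *\<^sub>R a"
      by simp
    then have "b = (- x / y) *\<^sub>R a"
      using \<open>y \<noteq> 0\<close> by simp
    then show False
      using assms(1) by blast
  qed
  then show ?thesis
    using assms by simp
qed

lemma norm_add_eq_norm_diff_iff:
  fixes a b :: "'a::real_inner"
  shows "norm (a - b) = norm (a + b) \<longleftrightarrow> a \<bullet> b = 0"
  using dot_norm[of a b] dot_norm_neg[of a b] by (auto simp: norm_eq inner_add inner_diff inner_commute)

section \<open>Shape and masses of two antipodal pairs\<close>

context planar_cc4
begin

text \<open>The counterpart of \<open>antipodal_pairs\<close> for four named bodies; it avoids
  composing \<open>q\<close> and \<open>m\<close> with a permutation until the types are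
  stated.\<close>

definition antipodal :: "nat \<Rightarrow> nat \<Rightarrow> nat \<Rightarrow> nat \<Rightarrow> bool" where
  "antipodal i j k l \<longleftrightarrow>
    labelling i j k l \<and> q i = - q k \<and> q j = - q l \<and> m i = m k \<and> m j = m l"

lemma antipodal_swap: "antipodal i j k l \<Longrightarrow> antipodal j i l k"
  unfolding antipodal_def labelling_def by auto

lemma antipodal_nonzero:
  assumes "antipodal i j k l"
  shows "q i \<noteq> 0"
proof -
  have "labelling i k j l"
    using assms labelling_perms unfolding antipodal_def by blast
  then show ?thesis
    using d_pos assms unfolding antipodal_def d_def by force
qed

text \<open>The equation of body \<open>i\<close> is a linear combination of the independent vectors
  \<open>q i\<close> and \<open>q j\<close>. The coefficient of \<open>q j\<close> gives
  \<open>d i j = d i l\<close>, hence orthogonality; the coefficient of \<open>q i\<close> gives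
  \<open>\<mu>\<close>.\<close>

lemma antipodal_cc_coefficients:
  assumes anti: "antipodal i j k l" and ncol: "\<And>t. q j \<noteq> t *\<^sub>R q i"
  shows "q i \<bullet> q j = 0" "\<mu> = 2 * m j / d i j ^ 3 + 2 * m i / (2 * norm (q i)) ^ 3"
proof -
  have lab: "labelling i j k l" and eq: "q k = - q i" "q l = - q j" "m k = m i" "m l = m j"
    using anti unfolding antipodal_def by auto
  let ?A = "m j / d i j ^ 3" and ?B = "m j / d i l ^ 3" and ?C = "m i / d i k ^ 3"
  have "?A *\<^sub>R (q j - q i) + ?C *\<^sub>R (- q i - q i) + ?B *\<^sub>R (- q j - q i) + \<mu> *\<^sub>R q i = 0"
    using cc_equation[OF lab] unfolding eq .
  moreover have "A *\<^sub>R (y - x) + C *\<^sub>R (- x - x) + B *\<^sub>R (- y - x) + \<mu> *\<^sub>R x =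
      (\<mu> - A - B - 2 * C) *\<^sub>R x + (A - B) *\<^sub>R y" for A B C and x y :: "real^3"
    by (simp add: vec_eq_iff algebra_simps)
  ultimately have "(\<mu> - ?A - ?B - 2 * ?C) *\<^sub>R q i + (?A - ?B) *\<^sub>R q j = 0"
    by simp
  then have co: "\<mu> - ?A - ?B - 2 * ?C = 0" "?A - ?B = 0"
    using not_multiple_imp_independent[OF ncol antipodal_nonzero[OF anti]] by blast+
  have "labelling i l j k"
    using lab unfolding labelling_def by auto
  then have pos: "d i j > 0" "d i l > 0" "m j > 0"
    using d_pos lab mass_pos by blast+
  then have "d i j ^ 3 = d i l ^ 3"
    using co(2) by simp
  then have "d i j = d i l"
    using pos by (simp add: power_eq_iff_eq_base)
  then show "q i \<bullet> q j = 0"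
    using norm_add_eq_norm_diff_iff[of "q i" "q j"] by (simp add: d_def eq)
  have "d i k = 2 * norm (q i)"
    by (simp add: d_def eq flip: scaleR_2)
  then show "\<mu> = 2 * m j / d i j ^ 3 + 2 * m i / (2 * norm (q i)) ^ 3"
    using co(1) \<open>d i j = d i l\<close> by simp
qed

lemma antipodal_masses:
  assumes anti: "antipodal i j k l" and ncol: "\<And>t. q j \<noteq> t *\<^sub>R q i"
    and le: "norm (q i) \<le> norm (q j)"
  shows "if norm (q i) = norm (q j) then m i = m j else m i > m j"
proof -
  define a b s where "a = norm (q i)" "b = norm (q j)" "s = d i j"
  have lab: "labelling i j k l"
    using anti unfolding antipodal_def by auto
  have pos: "a > 0" "b > 0" "s > 0" "m i > 0" "m j > 0"
    using antipodal_nonzero[OF anti] antipodal_nonzero[OF antipodal_swap[OF anti]] d_pos[OF lab]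
      mass_pos[OF lab] unfolding a_b_s_def by auto
  have ncol': "\<And>t. q i \<noteq> t *\<^sub>R q j"
    using ncol antipodal_nonzero[OF anti]
    by (metis scaleR_one scaleR_scaleR scaleR_zero_left left_inverse)
  have "q i \<bullet> q j = 0"
    using antipodal_cc_coefficients[OF anti ncol] by blast
  then have s: "s\<^sup>2 = a\<^sup>2 + b\<^sup>2"
    unfolding a_b_s_def d_def power2_norm_eq_inner by (simp add: inner_diff inner_commute)
  have "a\<^sup>2 \<le> b\<^sup>2"
    using le pos unfolding a_b_s_def by (intro power_mono) auto
  moreover have "(2 * b)\<^sup>2 = 4 * b\<^sup>2"
    by (simp add: power_mult_distrib)
  ultimately have "s\<^sup>2 < (2 * b)\<^sup>2"
    using s zero_less_power[OF pos(2), of 2] by linarith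
  then have "s < 2 * b"
    by (rule power2_less_imp_less) (use pos in simp)
  \<comment> \<open>The coefficients of \<open>m i\<close> and \<open>m j\<close> once the values of
    \<open>\<mu>\<close> from bodies \<open>i\<close> and \<open>j\<close> are equated.\<close>
  define x y where "x = 1 / s ^ 3 - 1 / (2 * a) ^ 3" "y = 1 / s ^ 3 - 1 / (2 * b) ^ 3"
  have "2 * m j / s ^ 3 + 2 * m i / (2 * a) ^ 3 = 2 * m i / s ^ 3 + 2 * m j / (2 * b) ^ 3"
    using antipodal_cc_coefficients(2)[OF anti ncol]
      antipodal_cc_coefficients(2)[OF antipodal_swap[OF anti] ncol']
    unfolding a_b_s_def by (simp add: d_commute)
  then have xy: "m i * x = m j * y"
    unfolding x_y_def by (simp add: right_diff_distrib)
  \<comment> \<open>The side is shorter than the longer diagonal. The sign of \<open>x\<close> does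
    not follow from such a comparison of lengths; it is inherited from \<open>y\<close> through
    \<open>xy\<close>.\<close>
  have "y > 0"
    using \<open>s < 2 * b\<close> pos unfolding x_y_def
    by (simp only: diff_gt_0_iff_gt) (intro divide_strict_left_mono power_strict_mono, auto)
  then have "x > 0"
    using xy pos by (metis mult_pos_pos zero_less_mult_pos)
  show ?thesis
  proof (cases "a = b")
    case True
    then have "x = y"
      unfolding x_y_def by simp
    then have "m i = m j"
      using xy \<open>y > 0\<close> by simp
    then show ?thesis
      using True unfolding a_b_s_def by simp
  next
    case False
    then have "a < b"
      using le unfolding a_b_s_def by simp
    then have "x < y"
      using pos unfolding x_y_def
      by (intro diff_strict_left_mono divide_strict_left_mono power_strict_mono) auto
    have "m i > m j"
    proof (rule ccontr)
      assume "\<not> ?thesis"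
      then have "m i * x \<le> m j * x"
        using \<open>x > 0\<close> by simp
      also have "\<dots> < m j * y"
        using \<open>x < y\<close> pos by simp
      finally show False
        using xy by simp
    qed
    then show ?thesis
      using False unfolding a_b_s_def by simp
  qed
qed

lemma antipodal_relabelling:
  assumes "antipodal i j k l"
  obtains \<sigma> where "\<sigma> permutes {1..4}" "\<sigma> 1 = i" "\<sigma> 2 = j" "\<sigma> 3 = k" "\<sigma> 4 = l"
    "antipodal_pairs (q \<circ> \<sigma>) (m \<circ> \<sigma>)"
proof -
  \<comment> \<open>The identity outside \<open>{1..4}\<close> is what \<open>permutes\<close>
    demands.\<close>
  define \<sigma> where "\<sigma> n = (if n = 1 then i else if n = 2 then j else if n = 3 then k
    else if n = 4 then l else n)" for n
  have lab: "distinct [i, j, k, l]" "{i, j, k, l} = {1..4}"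
    using assms unfolding antipodal_def labelling_def by auto
  have "{1..4} = {1, 2, 3, 4 :: nat}"
    by auto
  then have "bij_betw \<sigma> {1..4} {1..4}"
    using lab unfolding bij_betw_def inj_on_def \<sigma>_def by auto
  then have "\<sigma> permutes {1..4}"
    by (rule bij_imp_permutes) (auto simp: \<sigma>_def)
  then show thesis
    using assms by (intro that[of \<sigma>]) (auto simp: \<sigma>_def antipodal_def antipodal_pairs_def)
qed

text \<open>The ordering of the norms gives the shorter diagonal to bodies 1 and 3, as
  \<open>type_CCr\<close> requires. Dependent positions give the collinear type; otherwise the
  diagonals are orthogonal, and equal or unequal norms separate square from rhombus.\<close>

lemma antipodal_type_ordered:
  assumes anti: "antipodal i j k l" and le: "norm (q i) \<le> norm (q j)"
  shows "\<exists>\<sigma>. \<sigma> permutes {1..4} \<and> antipodal_pairs (q \<circ> \<sigma>) (m \<circ> \<sigma>) \<and>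
    (type_CCcl (q \<circ> \<sigma>) (m \<circ> \<sigma>) \<or> type_CCr (q \<circ> \<sigma>) (m \<circ> \<sigma>) \<or> type_CCs (q \<circ> \<sigma>) (m \<circ> \<sigma>))"
proof -
  obtain \<sigma> where perm: "\<sigma> permutes {1..4}" and \<sigma>: "\<sigma> 1 = i" "\<sigma> 2 = j" "\<sigma> 3 = k" "\<sigma> 4 = l"
    and pairs: "antipodal_pairs (q \<circ> \<sigma>) (m \<circ> \<sigma>)"
    using antipodal_relabelling[OF anti] .
  have eq: "q k = - q i" "q l = - q j" "m k = m i" "m l = m j"
    using anti unfolding antipodal_def by auto
  have "type_CCcl (q \<circ> \<sigma>) (m \<circ> \<sigma>) \<or> type_CCr (q \<circ> \<sigma>) (m \<circ> \<sigma>) \<or> type_CCs (q \<circ> \<sigma>) (m \<circ> \<sigma>)"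
  proof (cases "\<exists>t. q j = t *\<^sub>R q i")
    case True
    then show ?thesis
      using collinear_multiples[of "q i"] unfolding type_CCcl_def comp_def \<sigma> eq by metis
  next
    case False
    then have ncol: "\<And>t. q j \<noteq> t *\<^sub>R q i"
      by blast
    have orth: "q i \<bullet> q j = 0"
      using antipodal_cc_coefficients[OF anti ncol] by blast
    have "\<not> collinear {q i, q j, - q i}"
      using ncol collinear_antipodal[OF _ antipodal_nonzero[OF anti]] by metis
    moreover have "dist (q i) (q j) = dist (q j) (- q i)"
      using orth norm_add_eq_norm_diff_iff[of "q i" "q j"] by (simp add: dist_norm add.commute)
    ultimately have rhombus: "rhombus (q i) (q j) (q k) (q l)"
      by (simp add: rhombus_def parallelogram_def eq)
    have diagonals: "norm (q i - q k) = 2 * norm (q i)" "norm (q j - q l) = 2 * norm (q j)"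
      by (simp_all add: eq flip: scaleR_2)
    show ?thesis
    proof (cases "norm (q i) = norm (q j)")
      case True
      then have "orthogonal (q j - q i) (q l - q i)"
        using orth by (simp add: orthogonal_def eq inner_diff norm_eq inner_commute)
      then show ?thesis
        using True rhombus antipodal_masses[OF anti ncol le]
        unfolding type_CCs_def square_def comp_def \<sigma> eq by simp
    next
      case False
      then show ?thesis
        using le rhombus antipodal_masses[OF anti ncol le] diagonals
        unfolding type_CCr_def comp_def \<sigma> by simp
    qed
  qed
  then show ?thesis
    using perm pairs by blast
qed

lemma antipodal_type:
  assumes "antipodal i j k l"
  shows "\<exists>\<sigma>. \<sigma> permutes {1..4} \<and> antipodal_pairs (q \<circ> \<sigma>) (m \<circ> \<sigma>) \<and>
    (type_CCcl (q \<circ> \<sigma>) (m \<circ> \<sigma>) \<or> type_CCr (q \<circ> \<sigma>) (m \<circ> \<sigma>) \<or> type_CCs (q \<circ> \<sigma>) (m \<circ> \<sigma>))"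
  using antipodal_type_ordered[OF assms] antipodal_type_ordered[OF antipodal_swap[OF assms]]
  by (meson linear)

section \<open>Antipodal pairs and the balance condition\<close>

lemma antipodal_imp_collisionless:
  assumes "antipodal i j k l"
  shows "collisionless 4 q"
proof -
  have "{1..4} = {i, j, k, l}"
    using assms unfolding antipodal_def labelling_def by auto
  then show ?thesis
    using antipodal_nonzero[OF assms] antipodal_nonzero[OF antipodal_swap[OF assms]] assms
    unfolding collisionless_def antipodal_def by auto
qed

text \<open>Both members of an antipodal pair lie in the same shell and cancel there, whether or not
  the two pairs share a shell.\<close>

lemma antipodal_imp_balanced:
  assumes "antipodal i j k l"
  shows "balanced 4 q m"
proof -
  have set: "{1..4} = {i, j, k, l}" and dist: "distinct [i, j, k, l]"
    and eq: "q k = - q i" "q l = - q j" "m k = m i" "m l = m j"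
    using assms unfolding antipodal_def labelling_def by auto
  have "(\<Sum>x\<in>shell 4 q r. m x *\<^sub>R q x) = 0" for r
  proof -
    have "(\<Sum>x\<in>shell 4 q r. m x *\<^sub>R q x) =
        (\<Sum>x\<in>{i, j, k, l}. if norm (q x) = r then m x *\<^sub>R q x else 0)"
      unfolding shell_def set by (rule sum.inter_filter) simp
    also have "\<dots> = 0"
      using dist by (simp add: eq)
    finally show ?thesis .
  qed
  then show ?thesis
    unfolding balanced_def by blast
qed

text \<open>The shell sum makes the two weighted positions opposite; equal norms then force equal
  masses, which can be cancelled.\<close>

lemma shell_pair:
  assumes bal: "balanced 4 q m" and coll: "collisionless 4 q"
    and shell: "shell 4 q (norm (q i)) = {i, k}" "i \<noteq> k"
  shows "q i = - q k \<and> m i = m k"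
proof -
  have in4: "i \<in> {1..4}" "k \<in> {1..4}" and norms: "norm (q k) = norm (q i)"
    using shell unfolding shell_def by auto
  have ne: "q i \<noteq> 0" and pos: "m i > 0" "m k > 0"
    using coll in4 config unfolding collisionless_def planar_config_def by auto
  have "(\<Sum>x\<in>shell 4 q (norm (q i)). m x *\<^sub>R q x) = 0"
    using bal[unfolded balanced_def, rule_format, of "norm (q i)"] ne shell by simp
  then have sum: "m i *\<^sub>R q i = - (m k *\<^sub>R q k)"
    using shell by (simp add: eq_neg_iff_add_eq_0)
  then have "norm (m i *\<^sub>R q i) = norm (m k *\<^sub>R q k)"
    by simp
  then have "m i = m k"
    using norms ne pos by simp
  moreover from this sum have "m k *\<^sub>R (q i + q k) = 0"
    by (simp add: scaleR_add_right)
  ultimately show ?thesis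
    using pos by (simp add: eq_neg_iff_add_eq_0)
qed

lemma shell_partner:
  assumes bal: "balanced 4 q m" and coll: "collisionless 4 q" and i: "i \<in> {1..4}"
  obtains k where "k \<in> {1..4}" "k \<noteq> i" "norm (q k) = norm (q i)"
proof (rule ccontr)
  assume "\<not> thesis"
  then have shell: "shell 4 q (norm (q i)) = {i}"
    using that i unfolding shell_def by blast
  have ne: "q i \<noteq> 0" and pos: "m i > 0"
    using coll i config unfolding collisionless_def planar_config_def by auto
  then have "(\<Sum>x\<in>shell 4 q (norm (q i)). m x *\<^sub>R q x) = 0"
    using bal[unfolded balanced_def, rule_format, of "norm (q i)"] shell by simp
  then show False
    using ne pos shell by simp
qed

text \<open>Unless all bodies share a circle, some \<open>j\<close> lies off the shell of body 1.
  Both have partners in their own shells, and these four bodies are distinct, so the shells are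
  exactly two pairs.\<close>

lemma balanced_imp_antipodal:
  assumes bal: "balanced 4 q m" and coll: "collisionless 4 q"
  shows "\<exists>i j k l. antipodal i j k l"
proof (cases "\<forall>i\<in>{1..4}. norm (q i) = norm (q 1)")
  case True
  then interpret planar_cc4_circle P q m \<mu> "norm (q 1)"
    by unfold_locales blast
  obtain i j k l where "labelling i j k l" "q i = - q k" "q j = - q l" "m i = m k" "m j = m l"
    using circle_antipodal .
  then have "antipodal i j k l"
    unfolding antipodal_def by (intro conjI)
  then show ?thesis
    by blast
next
  case False
  then obtain j where j: "j \<in> {1..4}" "norm (q j) \<noteq> norm (q 1)"
    by blast
  obtain k where k: "k \<in> {1..4}" "k \<noteq> 1" "norm (q k) = norm (q 1)"
    using shell_partner[OF bal coll, of 1] by auto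
  obtain l where l: "l \<in> {1..4}" "l \<noteq> j" "norm (q l) = norm (q j)"
    using shell_partner[OF bal coll j(1)] .
  have dist: "distinct [1, j, k, l]"
    using j k l by auto
  have "{1, j, k, l} = {1..4}"
    by (rule card_subset_eq) (use j k l dist in auto)
  then have lab: "labelling 1 j k l"
    unfolding labelling_def using dist by (intro conjI)
  have shells: "shell 4 q (norm (q 1)) = {1, k}" "shell 4 q (norm (q j)) = {j, l}"
    unfolding shell_def \<open>{1, j, k, l} = {1..4}\<close>[symmetric] using j(2) k(3) l(3) by auto
  have "antipodal 1 j k l"
    using lab shell_pair[OF bal coll shells(1)] shell_pair[OF bal coll shells(2)] k(2) l(2)
    unfolding antipodal_def by (intro conjI) simp_all
  then show ?thesis
    by blast
qed

end

section \<open>The equivalence and the mutual exclusion of the types\<close>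

lemma permutes_labelling:
  assumes "\<sigma> permutes {1..4}"
  shows "labelling (\<sigma> 1) (\<sigma> 2) (\<sigma> 3) (\<sigma> 4)"
proof -
  have "{1..4} = {1, 2, 3, 4 :: nat}"
    by auto
  then have "{\<sigma> 1, \<sigma> 2, \<sigma> 3, \<sigma> 4} = {1..4}"
    using permutes_image[OF assms] by auto
  moreover have "inj \<sigma>"
    using assms by (rule permutes_inj)
  ultimately show ?thesis
    unfolding labelling_def by (simp add: inj_eq)
qed

theorem theorem3:
  fixes P :: "(real^3) set" and q :: "nat \<Rightarrow> real^3" and m :: "nat \<Rightarrow> real"
  assumes "planar_config P 4 q m"
    and "central_config 4 q m"
  shows "(balanced 4 q m \<and> collisionless 4 q \<longleftrightarrow>
           (\<exists>\<sigma>. \<sigma> permutes {1..4} \<and> antipodal_pairs (q \<circ> \<sigma>) (m \<circ> \<sigma>) \<and>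
              (type_CCcl (q \<circ> \<sigma>) (m \<circ> \<sigma>) \<or> type_CCr (q \<circ> \<sigma>) (m \<circ> \<sigma>) \<or> type_CCs (q \<circ> \<sigma>) (m \<circ> \<sigma>))))
       \<and> (\<forall>\<sigma> \<tau>. \<sigma> permutes {1..4} \<longrightarrow> \<tau> permutes {1..4} \<longrightarrow>
              \<not> (type_CCcl (q \<circ> \<sigma>) (m \<circ> \<sigma>) \<and> type_CCr (q \<circ> \<tau>) (m \<circ> \<tau>)) \<and>
              \<not> (type_CCcl (q \<circ> \<sigma>) (m \<circ> \<sigma>) \<and> type_CCs (q \<circ> \<tau>) (m \<circ> \<tau>)) \<and>
              \<not> (type_CCr (q \<circ> \<sigma>) (m \<circ> \<sigma>) \<and> type_CCs (q \<circ> \<tau>) (m \<circ> \<tau>)))"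
proof -
  obtain \<mu> where "planar_cc4 P q m \<mu>"
    by (rule central_config_equations[OF assms]) (blast intro: planar_cc4.intro assms(1))
  then interpret planar_cc4 P q m \<mu> .
  have "antipodal (\<sigma> 1) (\<sigma> 2) (\<sigma> 3) (\<sigma> 4)"
    if "\<sigma> permutes {1..4}" "antipodal_pairs (q \<circ> \<sigma>) (m \<circ> \<sigma>)" for \<sigma>
    using that(2) permutes_labelling[OF that(1)]
    unfolding antipodal_def antipodal_pairs_def comp_def by (intro conjI) simp_all
  then have "balanced 4 q m \<and> collisionless 4 q"
    if "\<sigma> permutes {1..4}" "antipodal_pairs (q \<circ> \<sigma>) (m \<circ> \<sigma>)" for \<sigma>
    using that antipodal_imp_balanced antipodal_imp_collisionless by blast
  then have iff: "balanced 4 q m \<and> collisionless 4 q \<longleftrightarrow>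
     (\<exists>\<sigma>. \<sigma> permutes {1..4} \<and> antipodal_pairs (q \<circ> \<sigma>) (m \<circ> \<sigma>) \<and>
        (type_CCcl (q \<circ> \<sigma>) (m \<circ> \<sigma>) \<or> type_CCr (q \<circ> \<sigma>) (m \<circ> \<sigma>) \<or> type_CCs (q \<circ> \<sigma>) (m \<circ> \<sigma>)))"
    using antipodal_type balanced_imp_antipodal by blast
  \<comment> \<open>Exclusion concerns two independent enumerations, so the types are separated by
    properties that do not depend on the enumeration, first by collinearity of the set of all
    positions.\<close>
  have positions: "{q (\<sigma> 1), q (\<sigma> 2), q (\<sigma> 3), q (\<sigma> 4)} = q ` {1..4}" if "\<sigma> permutes {1..4}" for \<sigma>
  proof -
    have "{\<sigma> 1, \<sigma> 2, \<sigma> 3, \<sigma> 4} = {1..4}"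
      using permutes_labelling[OF that] unfolding labelling_def by blast
    then have "q ` {\<sigma> 1, \<sigma> 2, \<sigma> 3, \<sigma> 4} = q ` {1..4}"
      by (rule arg_cong)
    then show ?thesis
      by (simp only: image_insert image_empty)
  qed
  have not_collinear: "\<not> collinear (q ` {1..4})"
    if "\<sigma> permutes {1..4}" "rhombus (q (\<sigma> 1)) (q (\<sigma> 2)) (q (\<sigma> 3)) (q (\<sigma> 4))" for \<sigma>
  proof -
    have "{q (\<sigma> 1), q (\<sigma> 2), q (\<sigma> 3)} \<subseteq> q ` {1..4}"
      using positions[OF that(1)] by blast
    then show ?thesis
      using that(2) collinear_subset unfolding rhombus_def parallelogram_def by blast
  qed
  \<comment> \<open>Rhombus and square are separated by the masses: a square in one enumeration
    makes all four masses equal, so none exceeds another in any enumeration.\<close>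
  have equal_masses: "m (\<sigma> 1) = m (\<sigma> 2)"
    if "\<sigma> permutes {1..4}" "\<tau> permutes {1..4}" "type_CCs (q \<circ> \<tau>) (m \<circ> \<tau>)" for \<sigma> \<tau>
  proof -
    have "m x = m (\<tau> 1)" if "x \<in> {\<tau> 1, \<tau> 2, \<tau> 3, \<tau> 4}" for x
      using that \<open>type_CCs (q \<circ> \<tau>) (m \<circ> \<tau>)\<close> unfolding type_CCs_def by auto
    then have "m x = m (\<tau> 1)" if "x \<in> {1..4}" for x
      using that permutes_labelling[OF \<open>\<tau> permutes {1..4}\<close>] unfolding labelling_def by blast
    then show ?thesis
      using bodies[OF permutes_labelling[OF that(1)]] by simp
  qed
  have cl: "collinear (q ` {1..4})" if "\<sigma> permutes {1..4}" "type_CCcl (q \<circ> \<sigma>) (m \<circ> \<sigma>)" for \<sigma>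
    using that(2) positions[OF that(1)] unfolding type_CCcl_def comp_def by simp
  have r: "\<not> collinear (q ` {1..4})" "m (\<sigma> 1) \<noteq> m (\<sigma> 2)"
    if "\<sigma> permutes {1..4}" "type_CCr (q \<circ> \<sigma>) (m \<circ> \<sigma>)" for \<sigma>
    using that(2) not_collinear[OF that(1)] unfolding type_CCr_def comp_def by simp_all
  have s: "\<not> collinear (q ` {1..4})"
    if "\<sigma> permutes {1..4}" "type_CCs (q \<circ> \<sigma>) (m \<circ> \<sigma>)" for \<sigma>
    using that(2) not_collinear[OF that(1)] unfolding type_CCs_def square_def comp_def by simp
  show ?thesis
    by (intro conjI allI impI iff) (use cl r s equal_masses in blast)+
qed

end
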